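(* Assume that $$\mathsf{A}\mathbf{e}_i\neq\eta\,\mathsf{A}\mathbf{e}_j\quad\forall i,j\in\{1,\dots,n\},\ i\neq j,\ \forall\eta\in\mathbb{R}.$$ Let $\mathsf{x}^*=\sum_{j\in\mathcal{J}}x_j^*\mathbf{e}_j\in\mathbb{R}^n$, where $\mathcal{J}=\mathrm{supp}(\mathsf{x}^* )$. If $$\mathrm{supp}(\mathsf{P}\mathbf{e}_j)\cap\mathrm{supp}(\mathsf{P}\mathbf{e}_k)=\emptyset\quad\text{for all } j,k\in\mathcal{J},\ j\neq k,$$ then $\mathsf{x}^*$ is the unique solution of $$\min_{\mathbf{x}\in\mathbb{R}^n}\|\mathsf{W}\mathbf{x}\|_1\quad\text{subject to}\quad\mathsf{A}\mathbf{x}=\mathsf{A}\mathsf{x}^*.$$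
   Context: $\mathsf{A}\in\mathbb{R}^{m\times n}$ is a matrix with nontrivial null space $\mathcal{N}(\mathsf{A})$, $\mathsf{A}^\dagger$ is its Moore-Penrose pseudo-inverse, and $\mathsf{P}=\mathsf{A}^\dagger\mathsf{A}$ is the orthogonal projection of $\mathbb{R}^n$ onto $\mathcal{N}(\mathsf{A})^\perp$. $\mathbf{e}_1,\dots,\mathbf{e}_n$ are the standard basis vectors of $\mathbb{R}^n$, and it is assumed that $\mathsf{P}\mathbf{e}_i\neq 0$ for all $i$. $\mathsf{W}\in\mathbb{R}^{n\times n}$ is the diagonal matrix defined by $\mathsf{W}\mathbf{e}_i=\|\mathsf{P}\mathbf{e}_i\|_2\,\mathbf{e}_i$. $\mathrm{supp}(\mathbf{v})=\{i: v_i\neq 0\}$. *)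

theory Defs
  imports "HOL-Analysis.Analysis"
begin

definition moore_penrose :: "real^'n^'m \<Rightarrow> real^'m^'n \<Rightarrow> bool" where
  "moore_penrose A X \<longleftrightarrow>
     A ** X ** A = A \<and> X ** A ** X = X \<and>
     transpose (A ** X) = A ** X \<and> transpose (X ** A) = X ** A"

definition pinv :: "real^'n^'m \<Rightarrow> real^'m^'n" where
  "pinv A = (THE X. moore_penrose A X)"

text \<open>The definite description is justified by \<open>moore_penrose_ex1\<close> below.\<close>

lemma generalized_inverse_exists:
  fixes A :: "real^'n^'m"
  shows "\<exists>G. A ** G ** A = A"
proof -
  have "linear ((*v) A)"
    by simp
  then obtain g where g: "linear g" "\<forall>v\<in>range ((*v) A). A *v g v = v"
    using linear_exists_right_inverse_on[OF _ subspace_UNIV, of "(*v) A"] by auto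
  have "(A ** matrix g ** A) *v x = A *v x" for x
    using g by (simp add: matrix_vector_mul_assoc[symmetric] matrix_works linear_linear)
  then show ?thesis
    by (metis matrix_eq)
qed

lemma gram_cancel:
  fixes A :: "real^'n^'m" and B :: "real^'k^'n"
  assumes "transpose A ** A ** B = transpose A ** A ** C"
  shows "A ** B = A ** C"
proof -
  have "A *v (B *v x) = A *v (C *v x)" for x
  proof -
    define y where "y = B *v x - C *v x"
    have "transpose A *v (A *v y) = 0"
      using arg_cong[OF assms, of "\<lambda>M. M *v x"]
      by (simp add: y_def matrix_vector_mul_assoc[symmetric] matrix_vector_mult_diff_distrib)
    then have "(A *v y) \<bullet> (A *v y) = 0"
      by (metis dot_lmul_matrix inner_commute inner_zero_right transpose_matrix_vector transpose_transpose)
    then show ?thesis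
      by (simp add: y_def matrix_vector_mult_diff_distrib)
  qed
  then show ?thesis
    by (metis matrix_eq matrix_vector_mul_assoc)
qed

lemma inverse13_exists:
  fixes A :: "real^'n^'m"
  shows "\<exists>X. A ** X ** A = A \<and> transpose (A ** X) = A ** X"
proof -
  obtain G where G: "transpose A ** A ** G ** (transpose A ** A) = transpose A ** A"
    using generalized_inverse_exists by blast
  define X where "X = G ** transpose A"
  have 1: "A ** X ** A = A"
    using gram_cancel[of A "G ** transpose A ** A" "mat 1"] G
    by (simp add: X_def matrix_mul_assoc)
  then have "transpose (A ** X ** A) = transpose A"
    by simp
  then have "transpose A ** transpose (A ** X) = transpose A"
    by (simp add: matrix_transpose_mul)
  then have "A ** X ** transpose (A ** X) = A ** X"
    by (simp add: X_def) (metis matrix_mul_assoc)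
  then have "transpose (A ** X) = A ** X"
    by (metis matrix_transpose_mul transpose_transpose)
  with 1 show ?thesis
    by blast
qed

lemma moore_penrose_unique:
  fixes A :: "real^'n^'m"
  assumes "moore_penrose A X" "moore_penrose A Y"
  shows "X = Y"
proof -
  have "A ** X = A ** Y ** (A ** X)"
    using assms by (simp add: moore_penrose_def matrix_mul_assoc)
  also have "\<dots> = transpose (A ** X ** (A ** Y))"
    using assms by (simp add: moore_penrose_def matrix_transpose_mul[of "A ** X" "A ** Y"])
  also have "\<dots> = A ** Y"
    using assms by (simp add: moore_penrose_def matrix_mul_assoc)
  finally have AX: "A ** X = A ** Y" .
  have "X ** A = X ** A ** (Y ** A)"
    using assms by (metis moore_penrose_def matrix_mul_assoc)
  also have "\<dots> = transpose (Y ** A ** (X ** A))"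
    using assms by (simp add: moore_penrose_def matrix_transpose_mul[of "Y ** A" "X ** A"])
  also have "\<dots> = Y ** A"
    using assms by (metis moore_penrose_def matrix_mul_assoc)
  finally have XA: "X ** A = Y ** A" .
  have "X = X ** (A ** X)"
    using assms by (simp add: moore_penrose_def matrix_mul_assoc)
  also have "\<dots> = Y ** A ** Y"
    by (metis AX XA matrix_mul_assoc)
  finally show ?thesis
    using assms by (simp add: moore_penrose_def)
qed

lemma moore_penrose_ex1:
  fixes A :: "real^'n^'m"
  shows "\<exists>!X. moore_penrose A X"
proof -
  obtain X where X: "A ** X ** A = A" "transpose (A ** X) = A ** X"
    using inverse13_exists by blast
  obtain K where K: "transpose A ** K ** transpose A = transpose A"
      "transpose (transpose A ** K) = transpose A ** K"
    using inverse13_exists by blast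
  define Y where "Y = transpose K"
  have Y: "A ** Y ** A = A" "transpose (Y ** A) = Y ** A"
    using arg_cong[OF K(1), of transpose] K(2)
    by (simp_all add: Y_def matrix_transpose_mul matrix_mul_assoc)
  have 1: "A ** (Y ** A ** X) = A ** X" and 2: "Y ** A ** X ** A = Y ** A"
    using X(1) Y(1) by (metis matrix_mul_assoc)+
  have "moore_penrose A (Y ** A ** X)"
    using 1 2 X Y by (metis moore_penrose_def matrix_mul_assoc)
  then show ?thesis
    using moore_penrose_unique by blast
qed

text \<open>The orthogonal projection onto the orthogonal complement of the null space of \<open>A\<close>.\<close>

definition row_proj :: "real^'n^'m \<Rightarrow> real^'n^'n" where
  "row_proj A = pinv A ** A"

definition weight_matrix :: "real^'n^'m \<Rightarrow> real^'n^'n" where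
  "weight_matrix A = (\<chi> i j. if i = j then norm (row_proj A *v axis i 1) else 0)"

definition supp :: "real^'n \<Rightarrow> 'n set" where
  "supp v = {i. v $ i \<noteq> 0}"

definition norm1 :: "real^'n \<Rightarrow> real" where
  "norm1 v = (\<Sum>i\<in>UNIV. \<bar>v $ i\<bar>)"

end

theory Submission
  imports Defs
begin

text \<open>
  Write \<open>P\<close> for \<open>row_proj A\<close>, \<open>p\<^sub>i\<close> for its \<open>i\<close>-th column, \<open>w\<^sub>i\<close> for the norm of \<open>p\<^sub>i\<close> and \<open>J\<close> for
  the support of \<open>xs\<close>. Since \<open>P\<close> is symmetric and idempotent, its entries are the inner products
  of its columns. The support condition, which speaks of entries, therefore makes the columns
  \<open>p\<^sub>j\<close> with \<open>j \<in> J\<close> pairwise orthogonal.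

  Optimality of \<open>xs\<close> is witnessed by the dual vector
  \<open>v = (\<Sum>j\<in>J. (sgn (xs $ j) / w\<^sub>j) *\<^sub>R p\<^sub>j)\<close>. It lies in the range of \<open>P\<close>, hence it has the same inner
  product with all feasible vectors. Orthogonality gives \<open>v $ i = sgn (xs $ i) * w\<^sub>i\<close> on \<open>J\<close>. For
  \<open>i \<notin> J\<close>, disjointness of the supports leaves at most one nonzero summand in \<open>v $ i\<close>, say
  \<open>\<plusminus> (p\<^sub>i \<bullet> p\<^sub>j) / w\<^sub>j\<close>, and strict Cauchy--Schwarz (\<open>strict_bound_off_diagonal\<close>) yields
  \<open>\<bar>v $ i\<bar> < w\<^sub>i\<close>, because \<open>p\<^sub>i\<close> and \<open>p\<^sub>j\<close> are not parallel when columns \<open>i\<close> and \<open>j\<close> of \<open>A\<close> are not. So every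
  feasible vector that does not vanish off \<open>J\<close> costs strictly more than \<open>xs\<close>
  (\<open>dual_certificate_strict\<close>). A feasible vector supported in \<open>J\<close> must be \<open>xs\<close> itself, because the
  orthogonal nonzero columns \<open>p\<^sub>j\<close>, \<open>j \<in> J\<close>, are linearly independent.
\<close>

lemma pinv_moore_penrose: "moore_penrose A (pinv A)"
  unfolding pinv_def by (rule theI'[OF moore_penrose_ex1])

lemma mult_row_proj: "A ** row_proj A = A"
  using pinv_moore_penrose[of A] by (simp add: moore_penrose_def row_proj_def matrix_mul_assoc)

lemma row_proj_idem: "row_proj A ** row_proj A = row_proj A"
  using pinv_moore_penrose[of A] by (simp add: moore_penrose_def row_proj_def matrix_mul_assoc)

lemma transpose_row_proj: "transpose (row_proj A) = row_proj A"
  using pinv_moore_penrose[of A] by (simp add: moore_penrose_def row_proj_def)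

lemma row_proj_axis_nth: "(row_proj A *v axis j 1) $ i = row_proj A $ i $ j"
  by (simp add: matrix_vector_mult_basis column_def)

lemma row_proj_entry_inner:
  "row_proj A $ i $ j = (row_proj A *v axis i 1) \<bullet> (row_proj A *v axis j 1)"
proof -
  have "(row_proj A *v axis i 1) \<bullet> (row_proj A *v axis j 1)
      = axis i 1 \<bullet> (row_proj A *v (row_proj A *v axis j 1))"
    by (metis dot_lmul_matrix transpose_row_proj transpose_matrix_vector)
  also have "\<dots> = row_proj A $ i $ j"
    by (simp add: matrix_vector_mul_assoc row_proj_idem inner_axis' row_proj_axis_nth)
  finally show ?thesis ..
qed

lemma row_proj_entry_diag: "row_proj A $ i $ i = (norm (row_proj A *v axis i 1))\<^sup>2"
  by (simp add: row_proj_entry_inner power2_norm_eq_inner)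

lemma inner_eq_0_of_disjoint_supp:
  assumes "supp u \<inter> supp v = {}"
  shows "u \<bullet> v = 0"
  using assms by (auto simp: inner_vec_def supp_def intro!: sum.neutral)

text \<open>
  Equality in Cauchy--Schwarz would make the two columns of the projection parallel, and \<open>A\<close> maps
  these columns to the corresponding columns of \<open>A\<close>.
\<close>

lemma strict_bound_off_diagonal:
  fixes A :: "real^'n^'m"
  assumes nz: "row_proj A *v axis j 1 \<noteq> 0"
    and nonparallel: "\<And>\<eta>. A *v axis i 1 \<noteq> \<eta> *\<^sub>R (A *v axis j 1)"
  shows "\<bar>row_proj A $ i $ j\<bar> < norm (row_proj A *v axis i 1) * norm (row_proj A *v axis j 1)"
proof -
  define p where "p = (\<lambda>k. row_proj A *v axis k 1)"
  have Ap: "A *v p k = A *v axis k 1" for k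
    by (simp add: p_def matrix_vector_mul_assoc mult_row_proj)
  have not_parallel: "p i \<noteq> \<eta> *\<^sub>R p j" for \<eta>
    using nonparallel[of \<eta>] Ap by (metis matrix_vector_mult_scaleR)
  have "\<bar>p i \<bullet> p j\<bar> \<noteq> norm (p i) * norm (p j)"
  proof
    assume "\<bar>p i \<bullet> p j\<bar> = norm (p i) * norm (p j)"
    then obtain c where c: "norm (p j) *\<^sub>R p i = c *\<^sub>R p j"
      unfolding norm_cauchy_schwarz_abs_eq by (metis minus_minus scaleR_minus_left)
    have "p i = inverse (norm (p j)) *\<^sub>R (norm (p j) *\<^sub>R p i)"
      using nz by (simp add: p_def)
    also have "\<dots> = (inverse (norm (p j)) * c) *\<^sub>R p j"
      by (simp add: c)
    finally show False
      using not_parallel by blast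
  qed
  then show ?thesis
    using Cauchy_Schwarz_ineq2[of "p i" "p j"] by (simp add: row_proj_entry_inner p_def)
qed

lemma norm1_weight_matrix:
  "norm1 (weight_matrix A *v x) = (\<Sum>i\<in>UNIV. norm (row_proj A *v axis i 1) * \<bar>x $ i\<bar>)"
  by (simp add: norm1_def weight_matrix_def matrix_vector_mult_def abs_mult if_distrib
      if_distribR sum.delta' cong: if_cong)

text \<open>
  Weak duality: \<open>v\<close> bounds the weighted norm of \<open>y\<close> from below by \<open>v \<bullet> y = v \<bullet> x\<close>, which is the
  weighted norm of \<open>x\<close>. A nonzero entry of \<open>y\<close> at which \<open>v\<close> is strictly below its weight makes
  the bound strict.
\<close>

lemma dual_certificate_strict:
  fixes v x y :: "real^'n"
  assumes same: "v \<bullet> y = v \<bullet> x"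
    and tight: "\<And>i. i \<in> supp x \<Longrightarrow> v $ i = sgn (x $ i) * w i"
    and slack: "\<And>i. i \<notin> supp x \<Longrightarrow> \<bar>v $ i\<bar> < w i"
    and w: "\<And>i. 0 \<le> w i"
    and k: "k \<notin> supp x" "y $ k \<noteq> 0"
  shows "(\<Sum>i\<in>UNIV. w i * \<bar>x $ i\<bar>) < (\<Sum>i\<in>UNIV. w i * \<bar>y $ i\<bar>)"
proof -
  have le: "\<bar>v $ i\<bar> \<le> w i" for i
    using tight[of i] slack[of i] w[of i]
    by (cases "i \<in> supp x") (auto simp: abs_mult abs_sgn_eq)
  have "w i * \<bar>x $ i\<bar> = v $ i * x $ i" for i
    using tight[of i] by (cases "i \<in> supp x") (auto simp: supp_def sgn_if)
  then have "(\<Sum>i\<in>UNIV. w i * \<bar>x $ i\<bar>) = v \<bullet> x"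
    by (simp add: inner_vec_def)
  also have "\<dots> = (\<Sum>i\<in>UNIV. v $ i * y $ i)"
    unfolding same[symmetric] by (simp add: inner_vec_def)
  also have "\<dots> \<le> (\<Sum>i\<in>UNIV. \<bar>v $ i\<bar> * \<bar>y $ i\<bar>)"
    by (intro sum_mono) (metis abs_ge_self abs_mult)
  also have "\<dots> < (\<Sum>i\<in>UNIV. w i * \<bar>y $ i\<bar>)"
  proof (rule sum_strict_mono_ex1)
    show "\<forall>i\<in>UNIV. \<bar>v $ i\<bar> * \<bar>y $ i\<bar> \<le> w i * \<bar>y $ i\<bar>"
      by (simp add: le mult_right_mono)
    show "\<exists>i\<in>UNIV. \<bar>v $ i\<bar> * \<bar>y $ i\<bar> < w i * \<bar>y $ i\<bar>"
      using slack[OF k(1)] k(2) by (intro bexI[of _ k]) (auto intro: mult_strict_right_mono)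
  qed simp
  finally show ?thesis .
qed

theorem theorem4p2:
  fixes A :: "real^'n^'m" and xs :: "real^'n"
  assumes null_space: "{x. A *v x = 0} \<noteq> {0}"
    and proj_nz: "\<And>i. row_proj A *v axis i 1 \<noteq> 0"
    and nonparallel: "\<And>i j \<eta>. i \<noteq> j \<Longrightarrow> A *v axis i 1 \<noteq> \<eta> *\<^sub>R (A *v axis j 1)"
    and disjoint_supp: "\<And>j k. j \<in> supp xs \<Longrightarrow> k \<in> supp xs \<Longrightarrow> j \<noteq> k \<Longrightarrow>
          supp (row_proj A *v axis j 1) \<inter> supp (row_proj A *v axis k 1) = {}"
  shows "\<forall>y. is_arg_min (\<lambda>x. norm1 (weight_matrix A *v x)) (\<lambda>x. A *v x = A *v xs) y \<longleftrightarrow> y = xs"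
proof -
  define P where "P = row_proj A"
  define w where "w = (\<lambda>i. norm (P *v axis i 1))"
  have w_pos: "0 < w i" for i
    using proj_nz by (simp add: w_def P_def)
  have diag: "P $ i $ i = (w i)\<^sup>2" for i
    by (simp add: P_def w_def row_proj_entry_diag)
  have orth: "P $ j $ k = 0" if "j \<in> supp xs" "k \<in> supp xs" "j \<noteq> k" for j k
    using inner_eq_0_of_disjoint_supp[OF disjoint_supp[OF that]]
    by (simp add: P_def row_proj_entry_inner)
  have one_nz: "P $ i $ j = 0" if "k \<in> supp xs" "P $ i $ k \<noteq> 0" "j \<in> supp xs" "j \<noteq> k" for i j k
    using disjoint_supp[of j k] that by (auto simp: supp_def row_proj_axis_nth P_def)
  define s :: "real^'n" where "s = (\<chi> j. sgn (xs $ j) / w j)"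
  define v where "v = P *v s"
  have s_off: "s $ j = 0" if "j \<notin> supp xs" for j
    using that by (simp add: s_def supp_def)
  have v_nth: "v $ i = (\<Sum>j\<in>UNIV. P $ i $ j * s $ j)" for i
    by (simp add: v_def matrix_vector_mult_def)
  have v_single: "v $ i = P $ i $ k * s $ k" if "k \<in> supp xs" "P $ i $ k \<noteq> 0" for i k
  proof -
    have "P $ i $ j * s $ j = 0" if "j \<noteq> k" for j
      using one_nz[OF \<open>k \<in> supp xs\<close> \<open>P $ i $ k \<noteq> 0\<close> _ that] s_off[of j]
      by (cases "j \<in> supp xs") auto
    then show ?thesis
      unfolding v_nth by (subst sum.remove[of _ k]) (simp_all add: sum.neutral del: mult_eq_0_iff)
  qed
  have tight: "v $ i = sgn (xs $ i) * w i" if "i \<in> supp xs" for i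
    using v_single[OF that, of i] w_pos[of i] by (simp add: diag s_def power2_eq_square)
  have slack: "\<bar>v $ i\<bar> < w i" if i: "i \<notin> supp xs" for i
  proof (cases "\<exists>k\<in>supp xs. P $ i $ k \<noteq> 0")
    case True
    then obtain k where k: "k \<in> supp xs" "P $ i $ k \<noteq> 0"
      by blast
    have "\<bar>P $ i $ k\<bar> < w i * w k"
      using strict_bound_off_diagonal[OF proj_nz, of i k] nonparallel[of i k] i k
      unfolding P_def w_def by blast
    moreover have "\<bar>v $ i\<bar> = \<bar>P $ i $ k\<bar> / w k"
      using v_single[OF k] k(1) w_pos[of k]
      by (simp add: s_def supp_def abs_mult abs_sgn_eq abs_divide)
    ultimately show ?thesis
      using w_pos[of k] by (simp add: divide_less_eq)
  next
    case False
    then have "v $ i = 0"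
      unfolding v_nth using s_off by (intro sum.neutral) auto
    then show ?thesis
      using w_pos by simp
  qed
  have strict: "norm1 (weight_matrix A *v xs) < norm1 (weight_matrix A *v y)"
    if feasible: "A *v y = A *v xs" and "y \<noteq> xs" for y
  proof -
    define h where "h = y - xs"
    have "A *v h = 0"
      by (simp add: h_def matrix_vector_mult_diff_distrib feasible)
    then have Ph: "P *v h = 0"
      by (simp add: P_def row_proj_def matrix_vector_mul_assoc[symmetric])
    have "v \<bullet> h = s \<bullet> (P *v h)"
      unfolding v_def P_def by (metis dot_lmul_matrix transpose_row_proj transpose_matrix_vector)
    then have same: "v \<bullet> y = v \<bullet> xs"
      unfolding Ph by (simp add: h_def inner_diff_right)
    \<comment> \<open>If \<open>h\<close> were supported in the support of \<open>xs\<close>, then entry \<open>i\<close> of \<open>P h = 0\<close> would reduce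
      to \<open>(w i)\<^sup>2 * h $ i = 0\<close> there, because the relevant columns are orthogonal.\<close>
    have "\<exists>k. k \<notin> supp xs \<and> y $ k \<noteq> 0"
    proof (rule ccontr)
      assume "\<nexists>k. k \<notin> supp xs \<and> y $ k \<noteq> 0"
      then have h_off: "h $ k = 0" if "k \<notin> supp xs" for k
        using that by (auto simp: h_def supp_def)
      have "h $ i = 0" if i: "i \<in> supp xs" for i
      proof -
        have "P $ i $ j * h $ j = 0" if "j \<noteq> i" for j
          using orth[OF i, of j] h_off[of j] that by (cases "j \<in> supp xs") auto
        then have "(P *v h) $ i = P $ i $ i * h $ i"
          unfolding matrix_vector_mult_def
          by (simp del: mult_eq_0_iff, subst sum.remove[of _ i]) (simp_all add: sum.neutral del: mult_eq_0_iff)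
        then show ?thesis
          using Ph w_pos[of i] by (simp add: diag)
      qed
      with h_off have "h = 0"
        by (metis vec_eq_iff zero_index)
      with \<open>y \<noteq> xs\<close> show False
        by (simp add: h_def)
    qed
    then obtain k where "k \<notin> supp xs" "y $ k \<noteq> 0"
      by blast
    from dual_certificate_strict[OF same tight slack _ this] w_pos show ?thesis
      by (simp add: norm1_weight_matrix w_def P_def less_imp_le)
  qed
  show ?thesis
    unfolding is_arg_min_def by (metis strict less_asym less_irrefl)
qed

end
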